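(* Let $\mathcal{M}=(S,A,O,T,Z,b_0)$ be a POMDP with target set $\mathrm{T}\subseteq S$, and suppose that it takes more than one time step to reach $\mathrm{T}$ in $\mathcal{M}$, i.e., $\mathrm{T}$ is reached with positive probability under some policy, but under no policy is $\mathrm{T}$ reached with positive probability at time $0$ or at time $1$. Let $0\le\gamma<1$ and let $\pi^\gamma$ be a policy maximizing over all policies $\pi$ the discounted value $$V^{\pi}_\gamma(b_0)=\mathbb{E}\Big[\sum_{t=0}^{\infty}\gamma^t R_{\mathrm{rp}}(b_t,\pi(b_t))\;\Big|\; b_0,\pi\Big].$$ Then $V^{\pi^\gamma}_\gamma(b_0)$ strictly under-approximates the optimal reachability probability: $$V^{\pi^\gamma}_\gamma(b_0)<P^{\pi^*}_{\mathcal{M}}(\lozenge\mathrm{T}),\qquad\text{where } P^{\pi^*}_{\mathcal{M}}(\lozenge\mathrm{T})=\sup_\pi P^\pi_{\mathcal{M}}(\lozenge \mathrm{T}).$$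
   Context: A POMDP is a tuple $\mathcal{M}=(S,A,O,T,Z,b_0)$ with finite sets $S,A,O$ of states, actions and observations, transition probabilities $T:S\times A\times S\to[0,1]$, observation probabilities $Z:S\times A\times O\to[0,1]$, and initial belief $b_0\in\Delta(S)$ (the probability simplex over $S$). At time $t$ the agent, holding belief $b_t$, takes action $a_t$; the hidden state moves from $s_t$ to $s_{t+1}$ with probability $T(s_t,a_t,s_{t+1})$, observation $o_t$ is emitted with probability $Z(s_{t+1},a_t,o_t)$, and the belief is updated by Bayes' rule, $b_{t+1}(s')\propto Z(s',a_t,o_t)\sum_{s}T(s,a_t,s')b_t(s)$. A policy is a map $\pi:\Delta(S)\to A$. $P^\pi_{\mathcal{M}}(\lozenge\mathrm{T})$ is the probability that the state ever enters $\mathrm{T}$ when starting from $b_0$ (that is, $s_0\sim b_0$) and following $\pi$. Reachability reward: the POMDP is augmented with an absorbing state $s_{\mathrm{T}}$. From every state of $\mathrm{T}$ the process moves with probability $1$ to $s_{\mathrm{T}}$, and it stays in $s_{\mathrm{T}}$ forever. The reward $R_{\mathrm{rp}}$ is $1$ on the step leaving a state of $\mathrm{T}$ (into $s_{\mathrm{T}}$), and $0$ on every other step; for a belief $b$, $R_{\mathrm{rp}}(b,a)$ is the expectation of $R_{\mathrm{rp}}(s,a)$ for $s\sim b$. Thus the reward $1$ is collected, at most once, at the first time $t$ at which the state is in $\mathrm{T}$, and for $\gamma=1$ the expected total reward equals $P^\pi_{\mathcal{M}}(\lozenge\mathrm{T})$.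
   Formalization: The optimal reachability probability is taken over policies on beliefs of the POMDP augmented with s_T, the same policies and process as for V; with policies on Δ(S) run in M itself, where T need not be absorbing, the inequality can fail. *)

theory Defs
  imports "HOL-Probability.Probability"
begin

text \<open>
  The finite sets of states, actions and observations are the universes of the types \<open>'s\<close>, \<open>'a\<close>
  and \<open>'o\<close> of class \<open>finite\<close>. Over a finite type \<open>'x\<close>, the type \<open>'x pmf\<close> is the probability
  simplex. So \<open>pmf (trans M s a) s'\<close> is \<open>T(s,a,s')\<close>, \<open>pmf (obs M s a) z\<close> is \<open>Z(s,a,z)\<close>, and
  \<open>'s pmf\<close> is the space of beliefs.
\<close>

record ('s, 'a, 'o) pomdp =
  trans :: "'s \<Rightarrow> 'a \<Rightarrow> 's pmf"
  obs :: "'s \<Rightarrow> 'a \<Rightarrow> 'o pmf"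
  init :: "'s pmf"

type_synonym ('s, 'a) policy = "'s pmf \<Rightarrow> 'a"

definition bayes_weight ::
  "('s::finite, 'a::finite, 'o::finite) pomdp \<Rightarrow> 's pmf \<Rightarrow> 'a \<Rightarrow> 'o \<Rightarrow> 's \<Rightarrow> real" where
  "bayes_weight M b a z s' = pmf (obs M s' a) z * (\<Sum>s\<in>UNIV. pmf (trans M s a) s' * pmf b s)"

text \<open>
  Bayes' rule. If all weights vanish, then the observation \<open>z\<close> has probability zero under \<open>b\<close> and
  \<open>a\<close>, and the (irrelevant) convention is to leave the belief unchanged.
\<close>

definition belief_update ::
  "('s::finite, 'a::finite, 'o::finite) pomdp \<Rightarrow> 's pmf \<Rightarrow> 'a \<Rightarrow> 'o \<Rightarrow> 's pmf" where
  "belief_update M b a z =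
     (if (\<Sum>s\<in>UNIV. bayes_weight M b a z s) = 0 then b
      else embed_pmf (\<lambda>s'. bayes_weight M b a z s' / (\<Sum>s\<in>UNIV. bayes_weight M b a z s)))"

lemma bayes_weight_nonneg: "0 \<le> bayes_weight M b a z s'"
  by (simp add: bayes_weight_def sum_nonneg)

lemma pmf_belief_update:
  assumes "(\<Sum>s\<in>UNIV. bayes_weight M b a z s) \<noteq> 0"
  shows "pmf (belief_update M b a z) s' =
    bayes_weight M b a z s' / (\<Sum>s\<in>UNIV. bayes_weight M b a z s)"
proof -
  let ?N = "\<Sum>s\<in>UNIV. bayes_weight M b a z s"
  have nn: "0 \<le> bayes_weight M b a z s / ?N" for s
    by (simp add: bayes_weight_nonneg sum_nonneg)
  have "(\<Sum>s\<in>UNIV. bayes_weight M b a z s / ?N) = 1"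
    using assms by (simp flip: sum_divide_distrib)
  then have "(\<integral>\<^sup>+s. ennreal (bayes_weight M b a z s / ?N) \<partial>count_space UNIV) = 1"
    using nn by (simp add: nn_integral_count_space_finite sum_ennreal)
  then show ?thesis
    using assms nn by (simp add: belief_update_def pmf_embed_pmf)
qed

text \<open>
  The hidden state together with the belief of the agent is a Markov process; its law on infinite
  trajectories \<open>\<omega>\<close>, with \<open>\<omega> t = (s\<^sub>t, b\<^sub>t)\<close>, is given by the Ionescu-Tulcea construction. The
  belief takes at most countably many values at each time, so the discrete sigma-algebra is used
  on each factor and no measurability condition on policies is needed.
\<close>

definition joint_init :: "('s, 'a, 'o) pomdp \<Rightarrow> ('s \<times> 's pmf) pmf" where
  "joint_init M = map_pmf (\<lambda>s. (s, init M)) (init M)"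

definition joint_step ::
  "('s::finite, 'a::finite, 'o::finite) pomdp \<Rightarrow> ('s, 'a) policy \<Rightarrow> 's \<times> 's pmf \<Rightarrow> ('s \<times> 's pmf) pmf"
  where
  "joint_step M \<pi> = (\<lambda>(s, b).
     do {
       s' \<leftarrow> trans M s (\<pi> b);
       z \<leftarrow> obs M s' (\<pi> b);
       return_pmf (s', belief_update M b (\<pi> b) z)
     })"

definition joint_kernel ::
  "('s::finite, 'a::finite, 'o::finite) pomdp \<Rightarrow> ('s, 'a) policy \<Rightarrow> nat
     \<Rightarrow> (nat \<Rightarrow> 's \<times> 's pmf) \<Rightarrow> ('s \<times> 's pmf) measure" where
  "joint_kernel M \<pi> t \<omega> =
     measure_pmf (case t of 0 \<Rightarrow> joint_init M | Suc n \<Rightarrow> joint_step M \<pi> (\<omega> n))"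

lemma Ionescu_Tulcea_joint_kernel:
  fixes M :: "('s::finite, 'a::finite, 'o::finite) pomdp"
  shows "Ionescu_Tulcea (joint_kernel M \<pi>) (\<lambda>_. count_space UNIV)"
proof (rule Ionescu_Tulcea.intro)
  fix i :: nat
  let ?X = "PiM {0..<i} (\<lambda>_. count_space UNIV) :: (nat \<Rightarrow> 's \<times> 's pmf) measure"
  show "joint_kernel M \<pi> i \<in> ?X \<rightarrow>\<^sub>M subprob_algebra (count_space UNIV)"
  proof (cases i)
    case 0
    then show ?thesis
      unfolding joint_kernel_def by (simp add: measure_pmf_in_subprob_algebra)
  next
    case (Suc n)
    have c: "(\<lambda>\<omega>. \<omega> n) \<in> ?X \<rightarrow>\<^sub>M count_space UNIV"
      using Suc by (intro measurable_component_singleton) auto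
    have "(\<lambda>x. measure_pmf (joint_step M \<pi> x))
        \<in> count_space UNIV \<rightarrow>\<^sub>M subprob_algebra (count_space UNIV)"
      by (simp add: measure_pmf_in_subprob_algebra)
    from measurable_compose[OF c this] show ?thesis
      by (simp add: Suc joint_kernel_def[abs_def])
  qed
next
  fix i and x :: "nat \<Rightarrow> 's \<times> 's pmf"
  show "prob_space (joint_kernel M \<pi> i x)"
    by (simp add: joint_kernel_def measure_pmf.prob_space_axioms)
qed

definition trajectories ::
  "('s::finite, 'a::finite, 'o::finite) pomdp \<Rightarrow> ('s, 'a) policy \<Rightarrow> (nat \<Rightarrow> 's \<times> 's pmf) measure" where
  "trajectories M \<pi> =
     projective_family.lim UNIV
       (Ionescu_Tulcea.CI (joint_kernel M \<pi>) (\<lambda>_. count_space UNIV)) (\<lambda>_. count_space UNIV)"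

lemma sets_trajectories:
  "sets (trajectories M \<pi>) = sets (PiM UNIV (\<lambda>_. count_space UNIV))"
proof -
  interpret IT: Ionescu_Tulcea "joint_kernel M \<pi>" "\<lambda>_. count_space UNIV"
    by (rule Ionescu_Tulcea_joint_kernel)
  show ?thesis
    by (simp add: trajectories_def IT.PF.sets_lim)
qed

definition state_at :: "nat \<Rightarrow> (nat \<Rightarrow> 's \<times> 's pmf) \<Rightarrow> 's" where
  "state_at t \<omega> = fst (\<omega> t)"

definition belief_at :: "nat \<Rightarrow> (nat \<Rightarrow> 's \<times> 's pmf) \<Rightarrow> 's pmf" where
  "belief_at t \<omega> = snd (\<omega> t)"

definition prob_in_at ::
  "('s::finite, 'a::finite, 'o::finite) pomdp \<Rightarrow> ('s, 'a) policy \<Rightarrow> 's set \<Rightarrow> nat \<Rightarrow> real" where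
  "prob_in_at M \<pi> X t =
     measure (trajectories M \<pi>) {\<omega> \<in> space (trajectories M \<pi>). state_at t \<omega> \<in> X}"

definition reach_prob ::
  "('s::finite, 'a::finite, 'o::finite) pomdp \<Rightarrow> ('s, 'a) policy \<Rightarrow> 's set \<Rightarrow> real" where
  "reach_prob M \<pi> X =
     measure (trajectories M \<pi>) {\<omega> \<in> space (trajectories M \<pi>). \<exists>t. state_at t \<omega> \<in> X}"

definition belief_reward :: "('s \<Rightarrow> 'a \<Rightarrow> real) \<Rightarrow> 's pmf \<Rightarrow> 'a \<Rightarrow> real" where
  "belief_reward R b a = measure_pmf.expectation b (\<lambda>s. R s a)"

definition discounted_value ::
  "('s::finite, 'a::finite, 'o::finite) pomdp \<Rightarrow> ('s \<Rightarrow> 'a \<Rightarrow> real) \<Rightarrow> real \<Rightarrow> ('s, 'a) policy \<Rightarrow> real"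
  where
  "discounted_value M R \<gamma> \<pi> =
     (\<integral>\<omega>. (\<Sum>t. \<gamma> ^ t * belief_reward R (belief_at t \<omega>) (\<pi> (belief_at t \<omega>))) \<partial>trajectories M \<pi>)"

text \<open>
  The POMDP augmented with the absorbing state \<open>None\<close>; the original states are \<open>Some s\<close>. The
  observation distribution \<open>zT\<close> of the absorbing state is a parameter. Up to and including the
  first visit to \<open>X\<close> the dynamics are those of \<open>M\<close>, so visiting \<open>Some ` X\<close> in \<open>augment M X zT\<close>
  amounts to visiting \<open>X\<close> in \<open>M\<close>. The beliefs and policies of the augmented POMDP are over
  \<open>'s option\<close>.
\<close>

definition augment ::
  "('s, 'a, 'o) pomdp \<Rightarrow> 's set \<Rightarrow> ('a \<Rightarrow> 'o pmf) \<Rightarrow> ('s option, 'a, 'o) pomdp" where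
  "augment M X zT =
     \<lparr> trans = (\<lambda>x a. case x of
          None \<Rightarrow> return_pmf None
        | Some s \<Rightarrow> if s \<in> X then return_pmf None else map_pmf Some (trans M s a)),
       obs = (\<lambda>x a. case x of None \<Rightarrow> zT a | Some s \<Rightarrow> obs M s a),
       init = map_pmf Some (init M) \<rparr>"

definition reach_reward :: "'s set \<Rightarrow> 's option \<Rightarrow> 'a \<Rightarrow> real" where
  "reach_reward X x a = (if x \<in> Some ` X then 1 else 0)"

end

theory Submission
  imports Defs
begin

text \<open>
  Write \<open>p t\<close> for the probability that the augmented process is in the target at time \<open>t\<close>. Beliefs are
  posteriors of the hidden state, so the discounted value of a policy is the sum of \<open>\<gamma> ^ t * p t\<close>.
  Visits to the target are absorbed, so the \<open>p t\<close> add up to at most the reachability probability,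
  and since \<open>p 0 = 0\<close>, the value is at most \<open>\<gamma>\<close> times it. It remains to see that the supremum is
  positive: a policy of the original POMDP that reaches the target with positive probability yields
  one for the augmented POMDP.
\<close>

section \<open>One-time marginals of the trajectory measure\<close>

text \<open>Iterating the step as a \<open>pmf\<close> gives the law of state and belief at time
  \<open>t\<close> without the infinite product; \<open>distr_joint_law\<close> identifies it as the
  marginal of \<open>trajectories\<close>.\<close>

primrec joint_law ::
  "('s::finite, 'a::finite, 'o::finite) pomdp \<Rightarrow> ('s, 'a) policy \<Rightarrow> nat \<Rightarrow> ('s \<times> 's pmf) pmf" where
  "joint_law M \<pi> 0 = joint_init M"
| "joint_law M \<pi> (Suc t) = bind_pmf (joint_law M \<pi> t) (joint_step M \<pi>)"

text \<open>The marginal of the projective limit on the empty index set is a probability measure,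
  and a measure with such an image has total mass 1 itself.\<close>

lemma prob_space_trajectories: "prob_space (trajectories M \<pi>)"
proof -
  interpret IT: Ionescu_Tulcea "joint_kernel M \<pi>" "\<lambda>_. count_space UNIV"
    by (rule Ionescu_Tulcea_joint_kernel)
  have "prob_space (distr IT.PF.lim (PiM {} (\<lambda>_. count_space UNIV)) (\<lambda>x. restrict x {}))"
    unfolding IT.distr_lim[OF finite.emptyI] by (rule IT.PF.prob_space_P) auto
  then show ?thesis
    unfolding trajectories_def by (rule prob_space_distrD[rotated])
      (intro measurable_restrict, auto)
qed

lemma measurable_nth_trajectories:
  "(\<lambda>\<omega>. \<omega> t) \<in> measurable (trajectories M \<pi>) (count_space UNIV)"
  unfolding measurable_cong_sets[OF sets_trajectories refl]
  by (rule measurable_component_singleton) simp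

lemma measurable_component_trajectories:
  "(\<lambda>\<omega>. f (\<omega> t)) \<in> borel_measurable (trajectories M \<pi>)"
  using measurable_compose[OF measurable_nth_trajectories, of f borel] by simp

text \<open>
  The product form is needed because the belief space is uncountable: an arbitrary function of the
  pair \<open>(\<omega> t, \<omega> (Suc t))\<close> need not be measurable for the product of discrete sigma-algebras.
\<close>

lemma nn_integral_trajectories:
  fixes f g :: "'s::finite \<times> 's pmf \<Rightarrow> ennreal"
    and M :: "('s, 'a::finite, 'o::finite) pomdp"
  shows "(\<integral>\<^sup>+\<omega>. f (\<omega> t) * g (\<omega> (Suc t)) \<partial>trajectories M \<pi>) =
    (\<integral>\<^sup>+\<omega>. f (\<omega> t) * (\<integral>\<^sup>+y. g y \<partial>joint_step M \<pi> (\<omega> t)) \<partial>trajectories M \<pi>)" (is ?step)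
    and "(\<integral>\<^sup>+\<omega>. g (\<omega> 0) \<partial>trajectories M \<pi>) = (\<integral>\<^sup>+y. g y \<partial>joint_init M)" (is ?init)
proof -
  define N :: "nat \<Rightarrow> ('s \<times> 's pmf) measure" where "N = (\<lambda>_. count_space UNIV)"
  interpret IT: Ionescu_Tulcea "joint_kernel M \<pi>" N
    unfolding N_def by (rule Ionescu_Tulcea_joint_kernel)
  have traj: "trajectories M \<pi> = IT.PF.lim"
    by (simp add: trajectories_def N_def)
  let ?C = "\<lambda>n. IT.C 0 n (\<lambda>_. undefined)"
  \<comment> \<open>The empty history: the only point of the product over no coordinates.\<close>
  have init: "(\<lambda>_. undefined) \<in> space (PiM {0..<0} N)"
    by (simp add: space_PiM PiE_def extensional_def)
  have CI: "IT.CI {0..<n} = ?C n" for n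
  proof -
    \<comment> \<open>\<open>CI\<close> restricts the law run up to \<open>up_to {0..<n}\<close>;
      running the kernels beyond \<open>n\<close> does not change the law of the first
      \<open>n\<close> coordinates.\<close>
    have "n \<le> IT.up_to {0..<n}"
      using IT.up_to[of "{0..<n}"] by (cases n) auto
    from IT.distr_C[OF this init] show ?thesis
      by (simp add: IT.CI_def)
  qed
  have restr: "(\<integral>\<^sup>+\<omega>. h (restrict \<omega> {0..<n}) \<partial>trajectories M \<pi>) = (\<integral>\<^sup>+\<omega>. h \<omega> \<partial>?C n)"
    if h: "h \<in> borel_measurable (PiM {0..<n} N)" for h :: "_ \<Rightarrow> ennreal" and n
  proof -
    have r: "(\<lambda>x. restrict x {0..<n}) \<in> measurable IT.PF.lim (PiM {0..<n} N)"
      unfolding measurable_cong_sets[OF IT.PF.sets_lim refl]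
      by (intro measurable_restrict measurable_component_singleton) auto
    show ?thesis
      unfolding traj CI[symmetric] IT.distr_lim[OF finite_atLeastLessThan, symmetric]
      using nn_integral_distr[OF r, of h] h by simp
  qed
  have comp: "(\<lambda>x. h (x i)) \<in> borel_measurable (PiM {0..<n} N)" if "i < n"
    for i n and h :: "_ \<Rightarrow> ennreal"
  proof -
    have "(\<lambda>x. x i) \<in> measurable (PiM {0..<n} N) (N i)"
      using that by (intro measurable_component_singleton) auto
    from measurable_compose[OF this, of h borel] show ?thesis by (simp add: N_def)
  qed
  \<comment> \<open>The law of \<open>Suc n\<close> coordinates binds that of \<open>n\<close>
    coordinates with \<open>eP n\<close>, which appends a coordinate drawn from the kernel at time
    \<open>n\<close>.\<close>
  have Suc: "(\<integral>\<^sup>+\<omega>. h \<omega> \<partial>?C (Suc n)) = (\<integral>\<^sup>+x. (\<integral>\<^sup>+y. h (x(n := y)) \<partial>joint_kernel M \<pi> n x) \<partial>?C n)"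
    if h: "h \<in> borel_measurable (PiM {0..<Suc n} N)" for h :: "_ \<Rightarrow> ennreal" and n
  proof -
    have e: "IT.eP n \<in> measurable (?C n) (subprob_algebra (PiM {0..<Suc n} N))"
      using IT.measurable_eP[of n]
      unfolding measurable_cong_sets[OF IT.sets_C[OF init] refl] by simp
    have "(\<integral>\<^sup>+\<omega>. h \<omega> \<partial>?C (Suc n)) = (\<integral>\<^sup>+x. (\<integral>\<^sup>+y. h y \<partial>IT.eP n x) \<partial>?C n)"
      using nn_integral_bind[OF h e] by simp
    also have "\<dots> = (\<integral>\<^sup>+x. (\<integral>\<^sup>+y. h (x(n := y)) \<partial>joint_kernel M \<pi> n x) \<partial>?C n)"
      using h by (intro nn_integral_cong IT.nn_integral_eP) (simp_all add: IT.space_C[OF init])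
    finally show ?thesis .
  qed
  show ?step
  proof -
    have "(\<integral>\<^sup>+\<omega>. f (\<omega> t) * g (\<omega> (Suc t)) \<partial>trajectories M \<pi>) =
        (\<integral>\<^sup>+\<omega>. f (\<omega> t) * g (\<omega> (Suc t)) \<partial>?C (Suc (Suc t)))"
      using restr[of "\<lambda>\<omega>. f (\<omega> t) * g (\<omega> (Suc t))" "Suc (Suc t)"]
      by (simp add: comp borel_measurable_times_ennreal)
    also have "\<dots> = (\<integral>\<^sup>+x. (\<integral>\<^sup>+y. f (x t) * g y \<partial>joint_step M \<pi> (x t)) \<partial>?C (Suc t))"
      using Suc[of "\<lambda>\<omega>. f (\<omega> t) * g (\<omega> (Suc t))" "Suc t"]
      by (simp add: comp borel_measurable_times_ennreal joint_kernel_def)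
    also have "\<dots> = (\<integral>\<^sup>+x. f (x t) * (\<integral>\<^sup>+y. g y \<partial>joint_step M \<pi> (x t)) \<partial>?C (Suc t))"
      by (simp add: nn_integral_cmult)
    also have "\<dots> = (\<integral>\<^sup>+\<omega>. f (\<omega> t) * (\<integral>\<^sup>+y. g y \<partial>joint_step M \<pi> (\<omega> t)) \<partial>trajectories M \<pi>)"
      using restr[OF comp[of t "Suc t" "\<lambda>x. f x * (\<integral>\<^sup>+y. g y \<partial>joint_step M \<pi> x)"]] by simp
    finally show ?thesis .
  qed
  show ?init
  proof -
    have "(\<integral>\<^sup>+\<omega>. g (\<omega> 0) \<partial>trajectories M \<pi>) = (\<integral>\<^sup>+\<omega>. g (\<omega> 0) \<partial>?C (Suc 0))"
      using restr[OF comp[of 0 "Suc 0" g]] by simp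
    also have "\<dots> = (\<integral>\<^sup>+x. (\<integral>\<^sup>+y. g y \<partial>joint_init M) \<partial>?C 0)"
      using Suc[OF comp[of 0 "Suc 0" g]] by (simp add: joint_kernel_def del: IT.C.simps)
    also have "\<dots> = (\<integral>\<^sup>+y. g y \<partial>joint_init M)"
      using init by (simp add: nn_integral_return)
    finally show ?thesis .
  qed
qed

text \<open>Induction over all \<open>f\<close> at once: a step replaces \<open>f\<close> by its
  expectation under \<open>joint_step\<close>, a different function evaluated one time unit
  earlier.\<close>

lemma nn_integral_joint_law:
  "(\<integral>\<^sup>+\<omega>. f (\<omega> t) \<partial>trajectories M \<pi>) = (\<integral>\<^sup>+x. f x \<partial>joint_law M \<pi> t)"
proof (induction t arbitrary: f)
  case 0
  then show ?case by (simp add: nn_integral_trajectories(2))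
next
  case (Suc t)
  have "(\<integral>\<^sup>+\<omega>. f (\<omega> (Suc t)) \<partial>trajectories M \<pi>) =
      (\<integral>\<^sup>+\<omega>. (\<integral>\<^sup>+y. f y \<partial>joint_step M \<pi> (\<omega> t)) \<partial>trajectories M \<pi>)"
    using nn_integral_trajectories(1)[where f = "\<lambda>_. 1" and g = f] by simp
  also have "\<dots> = (\<integral>\<^sup>+x. (\<integral>\<^sup>+y. f y \<partial>joint_step M \<pi> x) \<partial>joint_law M \<pi> t)"
    by (rule Suc.IH)
  finally show ?case by simp
qed

lemma distr_joint_law:
  "distr (trajectories M \<pi>) (count_space UNIV) (\<lambda>\<omega>. \<omega> t) = measure_pmf (joint_law M \<pi> t)"
proof (rule measure_eqI)
  fix A
  have "emeasure (distr (trajectories M \<pi>) (count_space UNIV) (\<lambda>\<omega>. \<omega> t)) A =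
      (\<integral>\<^sup>+\<omega>. indicator A (\<omega> t) \<partial>trajectories M \<pi>)"
    using nn_integral_distr[OF measurable_nth_trajectories, of "indicator A"] by simp
  also have "\<dots> = emeasure (measure_pmf (joint_law M \<pi> t)) A"
    by (simp add: nn_integral_joint_law)
  finally show "emeasure (distr (trajectories M \<pi>) (count_space UNIV) (\<lambda>\<omega>. \<omega> t)) A =
      emeasure (measure_pmf (joint_law M \<pi> t)) A" .
qed simp

lemma prob_in_at_joint_law:
  "prob_in_at M \<pi> X t = measure_pmf.prob (joint_law M \<pi> t) {x. fst x \<in> X}"
  unfolding prob_in_at_def distr_joint_law[symmetric]
  by (subst measure_distr[OF measurable_nth_trajectories])
    (auto intro!: arg_cong[where f = "measure _"] simp: state_at_def)

section \<open>Beliefs as posteriors of the hidden state\<close>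

lemma pmf_map_snd_finite:
  fixes p :: "('x::finite \<times> 'y) pmf"
  shows "pmf (map_pmf snd p) y = (\<Sum>x\<in>UNIV. pmf p (x, y))"
proof -
  have "snd -` {y} = (\<lambda>x. (x, y)) ` (UNIV :: 'x set)"
    by auto
  then show ?thesis
    by (simp add: pmf_map measure_measure_pmf_finite sum.reindex inj_on_def)
qed

text \<open>Joint law of the next state and the observation when the current state has law
  \<open>b\<close>; its masses are the unnormalized Bayes weights.\<close>

definition state_obs ::
  "('s::finite, 'a::finite, 'o::finite) pomdp \<Rightarrow> 's pmf \<Rightarrow> 'a \<Rightarrow> ('s \<times> 'o) pmf" where
  "state_obs M b a =
     bind_pmf (bind_pmf b (\<lambda>s. trans M s a)) (\<lambda>s'. map_pmf (Pair s') (obs M s' a))"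

lemma pmf_state_obs: "pmf (state_obs M b a) (s', z) = bayes_weight M b a z s'"
proof -
  have eq: "pmf (map_pmf (Pair x) (obs M x a)) (s', z) = (if x = s' then pmf (obs M s' a) z else 0)" for x
    by (cases "x = s'") (auto simp: pmf_map_inj' inj_on_def intro!: pmf_map_outside)
  show ?thesis
    by (simp add: state_obs_def pmf_bind integral_measure_pmf[of UNIV] bayes_weight_def eq
        if_distrib[of "\<lambda>x. _ * x"] mult.commute[of "pmf (obs _ _ _) _"]
        mult.commute[of "pmf (trans _ _ _) _"] cong: if_cong)
qed

text \<open>Bayes' rule: the updated belief is the conditional law of the next state given the observation.\<close>

lemma state_obs_posterior:
  "state_obs M b a = bind_pmf (map_pmf snd (state_obs M b a))
     (\<lambda>z. map_pmf (\<lambda>s. (s, z)) (belief_update M b a z))"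
proof (rule pmf_eqI, clarify)
  fix s' z
  let ?N = "\<Sum>s\<in>UNIV. bayes_weight M b a z s"
  have N: "pmf (map_pmf snd (state_obs M b a)) z = ?N"
    by (simp add: pmf_map_snd_finite pmf_state_obs)
  have eq: "pmf (map_pmf (\<lambda>s. (s, z')) (belief_update M b a z')) (s', z) =
      (if z' = z then pmf (belief_update M b a z) s' else 0)" for z'
    by (cases "z' = z")
      (auto simp: pmf_map_inj'[where f = "\<lambda>s. (s, z)"] inj_on_def intro!: pmf_map_outside)
  have "pmf (bind_pmf (map_pmf snd (state_obs M b a))
      (\<lambda>z. map_pmf (\<lambda>s. (s, z)) (belief_update M b a z))) (s', z) =
      ?N * pmf (belief_update M b a z) s'"
    by (simp add: pmf_bind[of "map_pmf snd _"] integral_measure_pmf[of UNIV] N eq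
        if_distrib[of "\<lambda>x. _ * x"] del: integral_map_pmf cong: if_cong)
  also have "\<dots> = bayes_weight M b a z s'"
  \<comment> \<open>An observation of probability zero has only zero weights, so the default value
    of \<open>belief_update\<close> is multiplied by zero.\<close>
  proof (cases "?N = 0")
    case True
    then have "bayes_weight M b a z s' = 0"
      by (simp add: sum_nonneg_eq_0_iff bayes_weight_nonneg)
    with True show ?thesis by simp
  qed (simp add: pmf_belief_update)
  finally show "pmf (state_obs M b a) (s', z) = pmf (bind_pmf (map_pmf snd (state_obs M b a))
      (\<lambda>z. map_pmf (\<lambda>s. (s, z)) (belief_update M b a z))) (s', z)"
    by (simp add: pmf_state_obs)
qed

text \<open>The witness \<open>\<nu>\<close> is the law of the next belief. Several observations may
  lead to one belief, but the posterior depends on the observation through that belief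
  alone.\<close>

lemma joint_step_posterior:
  "\<exists>\<nu>. bind_pmf b (\<lambda>s. joint_step M \<pi> (s, b)) = bind_pmf \<nu> (\<lambda>b'. map_pmf (\<lambda>s. (s, b')) b')"
proof -
  let ?J = "state_obs M b (\<pi> b)"
  have "bind_pmf b (\<lambda>s. joint_step M \<pi> (s, b)) =
      map_pmf (\<lambda>(s', z). (s', belief_update M b (\<pi> b) z)) ?J"
    unfolding joint_step_def state_obs_def
    by (simp add: map_bind_pmf bind_assoc_pmf map_pmf_comp) (simp add: map_pmf_def)
  also have "\<dots> = bind_pmf (map_pmf (belief_update M b (\<pi> b)) (map_pmf snd ?J))
      (\<lambda>b'. map_pmf (\<lambda>s. (s, b')) b')"
    by (subst state_obs_posterior) (simp add: map_bind_pmf bind_map_pmf map_pmf_comp)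
  finally show ?thesis by blast
qed

text \<open>Invariant of the process: given the belief, the state is distributed according to it.
  The induction carries an arbitrary mixing law \<open>\<nu>\<close>, identified only at the
  end.\<close>

lemma joint_law_posterior:
  "joint_law M \<pi> t = bind_pmf (map_pmf snd (joint_law M \<pi> t)) (\<lambda>b. map_pmf (\<lambda>s. (s, b)) b)"
proof -
  have "\<exists>\<nu>. joint_law M \<pi> t = bind_pmf \<nu> (\<lambda>b. map_pmf (\<lambda>s. (s, b)) b)"
  proof (induction t)
    case 0
    have "joint_law M \<pi> 0 = bind_pmf (return_pmf (init M)) (\<lambda>b. map_pmf (\<lambda>s. (s, b)) b)"
      by (simp add: joint_init_def bind_return_pmf)
    then show ?case by blast
  next
    case (Suc t)
    then obtain \<nu> where \<nu>: "joint_law M \<pi> t = bind_pmf \<nu> (\<lambda>b. map_pmf (\<lambda>s. (s, b)) b)"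
      by blast
    have "\<forall>b. \<exists>\<nu>. bind_pmf b (\<lambda>s. joint_step M \<pi> (s, b)) =
        bind_pmf \<nu> (\<lambda>b'. map_pmf (\<lambda>s. (s, b')) b')"
      by (intro allI joint_step_posterior)
    from choice[OF this] obtain \<mu> where \<mu>: "\<And>b. bind_pmf b (\<lambda>s. joint_step M \<pi> (s, b)) =
        bind_pmf (\<mu> b) (\<lambda>b'. map_pmf (\<lambda>s. (s, b')) b')"
      by blast
    have "joint_law M \<pi> (Suc t) = bind_pmf (bind_pmf \<nu> \<mu>) (\<lambda>b. map_pmf (\<lambda>s. (s, b)) b)"
      by (simp add: \<nu> bind_assoc_pmf bind_map_pmf \<mu>)
    then show ?case by blast
  qed
  then obtain \<nu> where \<nu>: "joint_law M \<pi> t = bind_pmf \<nu> (\<lambda>b. map_pmf (\<lambda>s. (s, b)) b)"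
    by blast
  \<comment> \<open>Projecting each component of the mixture to the belief leaves a point mass, so
    \<open>\<nu>\<close> is the marginal.\<close>
  have "map_pmf snd (joint_law M \<pi> t) = \<nu>"
    by (simp add: \<nu> map_bind_pmf map_pmf_comp bind_return_pmf')
  with \<nu> show ?thesis by simp
qed

text \<open>Tower property: averaging the posterior probability of \<open>X\<close> gives its
  unconditional probability.\<close>

lemma expectation_belief_at:
  "(\<integral>\<omega>. measure_pmf.prob (belief_at t \<omega>) X \<partial>trajectories M \<pi>) = prob_in_at M \<pi> X t"
proof -
  let ?L = "joint_law M \<pi> t"
  have "(\<integral>\<^sup>+\<omega>. ennreal (measure_pmf.prob (belief_at t \<omega>) X) \<partial>trajectories M \<pi>) =
      (\<integral>\<^sup>+b. emeasure (measure_pmf b) X \<partial>map_pmf snd ?L)"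
    by (simp add: belief_at_def nn_integral_joint_law[where f = "\<lambda>x. ennreal (measure_pmf.prob (snd x) X)"]
        measure_pmf.emeasure_eq_measure)
  also have "\<dots> = emeasure (measure_pmf (bind_pmf (map_pmf snd ?L) (\<lambda>b. map_pmf (\<lambda>s. (s, b)) b)))
      {x. fst x \<in> X}"
    by (simp only: emeasure_bind_pmf emeasure_map_pmf) (simp add: vimage_def)
  also have "\<dots> = ennreal (prob_in_at M \<pi> X t)"
    by (simp only: joint_law_posterior[symmetric] prob_in_at_joint_law measure_pmf.emeasure_eq_measure)
  finally show ?thesis
    by (intro integral_eq_nn_integral[THEN trans])
      (auto simp: prob_in_at_def belief_at_def intro: measurable_component_trajectories)
qed

section \<open>Reachability events and the discounted value as a series\<close>

lemma prob_in_at_nonneg: "0 \<le> prob_in_at M \<pi> X t"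
  by (simp add: prob_in_at_def)

lemma measurable_state_at:
  "Measurable.pred (trajectories M \<pi>) (\<lambda>\<omega>. state_at t \<omega> \<in> X)"
proof -
  from measurable_compose[OF measurable_nth_trajectories, of "\<lambda>x. fst x \<in> X" "count_space UNIV"]
  show ?thesis
    by (simp add: state_at_def)
qed

lemma reach_event_sets:
  "{\<omega> \<in> space (trajectories M \<pi>). \<exists>t. state_at t \<omega> \<in> X} \<in> sets (trajectories M \<pi>)"
  using measurable_state_at by measurable

lemma prob_in_at_le_reach_prob: "prob_in_at M \<pi> X t \<le> reach_prob M \<pi> X"
proof -
  interpret prob_space "trajectories M \<pi>" by (rule prob_space_trajectories)
  show ?thesis
    unfolding prob_in_at_def reach_prob_def
    by (rule finite_measure_mono[OF _ reach_event_sets]) auto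
qed

text \<open>The reachability event is a countable union over times, and a countable union of null
  events is null.\<close>

lemma reach_prob_pos_imp:
  assumes "reach_prob M \<pi> X > 0"
  obtains t where "prob_in_at M \<pi> X t > 0"
proof -
  interpret prob_space "trajectories M \<pi>" by (rule prob_space_trajectories)
  have "AE \<omega> in trajectories M \<pi>. \<forall>t. state_at t \<omega> \<notin> X" if "\<And>t. prob_in_at M \<pi> X t = 0"
    unfolding AE_all_countable
  proof
    fix t
    have "{\<omega> \<in> space (trajectories M \<pi>). state_at t \<omega> \<in> X} \<in> sets (trajectories M \<pi>)"
      using measurable_state_at by measurable
    with that[of t] show "AE \<omega> in trajectories M \<pi>. state_at t \<omega> \<notin> X"
      by (subst AE_iff_measurable[OF _ refl]) (auto simp: prob_in_at_def emeasure_eq_measure)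
  qed
  then have "reach_prob M \<pi> X = 0" if "\<And>t. prob_in_at M \<pi> X t = 0"
    unfolding reach_prob_def using that
    by (subst measure_eq_AE[where B = "{}"]) (auto intro: reach_event_sets)
  with assms obtain t where "prob_in_at M \<pi> X t \<noteq> 0"
    by fastforce
  then show thesis
    by (intro that[of t]) (simp add: prob_in_at_def zero_less_measure_iff)
qed

text \<open>Probabilities are at most 1, so the geometric series dominates and sum and integral may
  be exchanged; the tower property then evaluates each term.\<close>

lemma discounted_value_eq_suminf:
  assumes "0 \<le> \<gamma>" "\<gamma> < 1"
  shows "discounted_value M (reach_reward X) \<gamma> \<pi> = (\<Sum>t. \<gamma> ^ t * prob_in_at M \<pi> (Some ` X) t)"
proof -
  let ?\<Omega> = "trajectories M \<pi>"
  let ?r = "\<lambda>t \<omega>. measure_pmf.prob (belief_at t \<omega>) (Some ` X)"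
  interpret prob_space ?\<Omega> by (rule prob_space_trajectories)
  \<comment> \<open>The reward ignores the action and is the indicator of the target, so its
    expectation is the mass that the belief gives to the target.\<close>
  have reward: "belief_reward (reach_reward X) b a = measure_pmf.prob b (Some ` X)" for b and a :: 'b
  proof -
    have "(\<lambda>x. reach_reward X x a) = indicator (Some ` X)"
      by (auto simp: reach_reward_def fun_eq_iff)
    then show ?thesis by (simp add: belief_reward_def)
  qed
  have meas: "?r t \<in> borel_measurable ?\<Omega>" for t
    unfolding belief_at_def by (rule measurable_component_trajectories)
  have int: "integrable ?\<Omega> (\<lambda>\<omega>. \<gamma> ^ t * ?r t \<omega>)" for t
    by (intro integrable_mult_right integrable_const_bound[where B = 1]) (auto intro: meas)
  have geom: "summable (\<lambda>t. \<gamma> ^ t)"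
    using assms by (simp add: summable_geometric)
  have bound: "\<gamma> ^ t * p \<le> \<gamma> ^ t" if "p \<le> 1" for p and t :: nat
    using that assms by (simp add: mult_left_le)
  have "(\<integral>\<omega>. (\<Sum>t. \<gamma> ^ t * ?r t \<omega>) \<partial>?\<Omega>) = (\<Sum>t. \<integral>\<omega>. \<gamma> ^ t * ?r t \<omega> \<partial>?\<Omega>)"
  proof (rule integral_suminf[OF int])
    have "summable (\<lambda>t. norm (\<gamma> ^ t * ?r t \<omega>))" for \<omega>
      using assms by (intro summable_comparison_test'[OF geom, of 0]) (simp add: bound)
    then show "AE \<omega> in ?\<Omega>. summable (\<lambda>t. norm (\<gamma> ^ t * ?r t \<omega>))" by simp
    show "summable (\<lambda>t. \<integral>\<omega>. norm (\<gamma> ^ t * ?r t \<omega>) \<partial>?\<Omega>)"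
      using assms by (intro summable_comparison_test'[OF geom, of 0])
        (simp add: expectation_belief_at bound prob_in_at_def)
  qed
  then show ?thesis
    by (simp add: discounted_value_def reward expectation_belief_at)
qed

section \<open>Absorption bounds the expected number of target visits\<close>

lemma map_fst_joint_step: "map_pmf fst (joint_step M \<pi> x) = trans M (fst x) (\<pi> (snd x))"
  by (cases x) (simp add: joint_step_def map_bind_pmf bind_return_pmf')

lemma emeasure_joint_step_augment_absorbed:
  "emeasure (joint_step (augment M X zT) \<pi> x) {y. fst y = None} =
     indicator {x. fst x \<in> insert None (Some ` X)} x"
proof -
  \<comment> \<open>Outside the target the augmented dynamics stay in the range of
    \<open>Some\<close>, hence the step into \<open>None\<close> has probability 0 or 1.\<close>
  have none: "Some -` {None} = ({} :: 'a set)" by auto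
  have "emeasure (joint_step (augment M X zT) \<pi> x) {y. fst y = None} =
      emeasure (map_pmf fst (joint_step (augment M X zT) \<pi> x)) {None}"
    by (simp add: vimage_def)
  also have "\<dots> = indicator {x. fst x \<in> insert None (Some ` X)} x"
    using none by (auto simp: map_fst_joint_step augment_def split: option.split split_indicator)
  finally show ?thesis .
qed

text \<open>Mass balance at \<open>None\<close>: nothing leaves it, and its inflow in each step is
  exactly the mass that was in the target.\<close>

lemma sum_prob_in_at_augment:
  "(\<Sum>t<n. prob_in_at (augment M X zT) \<pi> (Some ` X) t) = prob_in_at (augment M X zT) \<pi> {None} n"
proof (induction n)
  case 0
  show ?case
    by (simp add: prob_in_at_joint_law joint_init_def augment_def vimage_def)
next
  case (Suc n)
  let ?L = "joint_law (augment M X zT) \<pi> n"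
  have "ennreal (prob_in_at (augment M X zT) \<pi> {None} (Suc n)) =
      emeasure (joint_law (augment M X zT) \<pi> (Suc n)) {x. fst x = None}"
    by (simp add: prob_in_at_joint_law measure_pmf.emeasure_eq_measure del: joint_law.simps)
  also have "\<dots> = (\<integral>\<^sup>+x. indicator {x. fst x \<in> insert None (Some ` X)} x \<partial>?L)"
    unfolding joint_law.simps emeasure_bind_pmf emeasure_joint_step_augment_absorbed ..
  also have "\<dots> = ennreal (measure_pmf.prob ?L {x. fst x \<in> insert None (Some ` X)})"
    by (simp add: measure_pmf.emeasure_eq_measure)
  also have "{x. fst x \<in> insert None (Some ` X)} =
      {x. fst x \<in> Some ` X} \<union> {x :: 'a option \<times> 'a option pmf. fst x \<in> {None}}"
    by auto
  also have "measure_pmf.prob ?L \<dots> =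
      prob_in_at (augment M X zT) \<pi> (Some ` X) n + prob_in_at (augment M X zT) \<pi> {None} n"
    unfolding prob_in_at_joint_law by (rule measure_pmf.finite_measure_Union) auto
  finally show ?case
    using Suc by (simp add: prob_in_at_nonneg del: ennreal_plus)
qed

text \<open>Almost every trajectory that is in \<open>None\<close> has passed through the target,
  the only way in.\<close>

lemma prob_absorbed_le_reach_prob:
  "prob_in_at (augment M X zT) \<pi> {None} n \<le> reach_prob (augment M X zT) \<pi> (Some ` X)"
proof -
  let ?M = "augment M X zT"
  let ?\<Omega> = "trajectories ?M \<pi>"
  let ?B = "- insert None (Some ` X)"
  interpret prob_space ?\<Omega> by (rule prob_space_trajectories)
  have step: "AE \<omega> in ?\<Omega>. fst (\<omega> t) \<in> ?B \<longrightarrow> fst (\<omega> (Suc t)) \<noteq> None" for t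
  proof -
    \<comment> \<open>The bad event of entering \<open>None\<close> from \<open>?B\<close> is a
      product of indicators at consecutive times, so its probability integrates the one-step
      probability, which vanishes on \<open>?B\<close>.\<close>
    let ?f = "\<lambda>x. indicator {x. fst x \<in> ?B} x :: ennreal"
    let ?g = "\<lambda>x. indicator {x. fst x = None} x :: ennreal"
    have "(\<integral>\<^sup>+\<omega>. ?f (\<omega> t) * ?g (\<omega> (Suc t)) \<partial>?\<Omega>) =
        (\<integral>\<^sup>+\<omega>. ?f (\<omega> t) * emeasure (joint_step ?M \<pi> (\<omega> t)) {y. fst y = None} \<partial>?\<Omega>)"
      by (subst nn_integral_trajectories(1)) simp
    also have "\<dots> = (\<integral>\<^sup>+\<omega>. 0 \<partial>?\<Omega>)"
      unfolding emeasure_joint_step_augment_absorbed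
      by (intro nn_integral_cong) (simp split: split_indicator)
    also have "\<dots> = 0" by simp
    finally have "AE \<omega> in ?\<Omega>. ?f (\<omega> t) * ?g (\<omega> (Suc t)) = 0"
      by (subst (asm) nn_integral_0_iff_AE)
        (auto intro!: borel_measurable_times_ennreal measurable_component_trajectories)
    then show ?thesis
      by eventually_elim (auto split: split_indicator_asm)
  qed
  \<comment> \<open>The empty sum in the mass balance.\<close>
  have "prob_in_at ?M \<pi> {None} 0 = 0"
    using sum_prob_in_at_augment[of M X zT \<pi> 0] by simp
  moreover have "{\<omega> \<in> space ?\<Omega>. state_at 0 \<omega> \<in> {None}} \<in> sets ?\<Omega>"
    using measurable_state_at by measurable
  ultimately have init: "AE \<omega> in ?\<Omega>. fst (\<omega> 0) \<noteq> None"
    by (subst AE_iff_measurable[OF _ refl])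
      (auto simp: prob_in_at_def emeasure_eq_measure state_at_def)
  have "AE \<omega> in ?\<Omega>. \<forall>t. fst (\<omega> t) \<in> ?B \<longrightarrow> fst (\<omega> (Suc t)) \<noteq> None"
    unfolding AE_all_countable using step by blast
  with init have "AE \<omega> in ?\<Omega>. state_at n \<omega> \<in> {None} \<longrightarrow> (\<exists>t. state_at t \<omega> \<in> Some ` X)"
  proof eventually_elim
    case (elim \<omega>)
    \<comment> \<open>A trajectory that avoids the target starts in \<open>?B\<close> and, by
      induction along time, never leaves it.\<close>
    have "fst (\<omega> m) \<noteq> None" if "\<forall>t. fst (\<omega> t) \<notin> Some ` X" for m
      using that elim by (induction m) auto
    then show ?case unfolding state_at_def by blast
  qed
  then show ?thesis
    unfolding prob_in_at_def reach_prob_def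
    by (intro finite_measure_mono_AE reach_event_sets) auto
qed

text \<open>The term at time 0, the only undiscounted one, vanishes by assumption; each later one
  has a factor \<open>\<gamma> ^ t\<close> of at most \<open>\<gamma>\<close>. The undiscounted
  terms sum to at most the reachability probability.\<close>

lemma discounted_value_augment_le:
  assumes "0 \<le> \<gamma>" "\<gamma> < 1" and "prob_in_at (augment M X zT) \<pi> (Some ` X) 0 = 0"
  shows "discounted_value (augment M X zT) (reach_reward X) \<gamma> \<pi>
    \<le> \<gamma> * reach_prob (augment M X zT) \<pi> (Some ` X)"
proof -
  let ?p = "prob_in_at (augment M X zT) \<pi> (Some ` X)"
  have partial: "sum ?p {..<n} \<le> reach_prob (augment M X zT) \<pi> (Some ` X)" for n
    by (simp add: sum_prob_in_at_augment prob_absorbed_le_reach_prob)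
  then have summable: "summable ?p"
    by (intro summableI_nonneg_bounded prob_in_at_nonneg)
  have le: "\<gamma> ^ t * ?p t \<le> \<gamma> * ?p t" for t
  proof (cases t)
    case (Suc n)
    with assms(1,2) have "\<gamma> ^ t \<le> \<gamma>"
      by (simp add: mult_left_le power_le_one)
    then show ?thesis by (intro mult_right_mono prob_in_at_nonneg)
  qed (use assms in simp)
  have "summable (\<lambda>t. \<gamma> ^ t * ?p t)"
    using assms(1) le by (intro summable_comparison_test'[OF summable_mult[OF summable, of \<gamma>], of 0])
      (simp add: prob_in_at_nonneg)
  then have "discounted_value (augment M X zT) (reach_reward X) \<gamma> \<pi> \<le> (\<Sum>t. \<gamma> * ?p t)"
    unfolding discounted_value_eq_suminf[OF assms(1,2)]
    by (intro suminf_le le summable_mult summable)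
  also have "\<dots> = \<gamma> * suminf ?p"
    by (rule suminf_mult[OF summable])
  also have "\<dots> \<le> \<gamma> * reach_prob (augment M X zT) \<pi> (Some ` X)"
    using assms(1) partial by (intro mult_left_mono suminf_le_const summable)
  finally show ?thesis .
qed

section \<open>Transfer of reachability to the augmented POMDP\<close>

lemma sum_UNIV_option:
  fixes f :: "'x::finite option \<Rightarrow> 'y::comm_monoid_add"
  shows "(\<Sum>x\<in>UNIV. f x) = f None + (\<Sum>x\<in>UNIV. f (Some x))"
  by (simp add: UNIV_option_conv sum.reindex)

lemma pmf_map_Some:
  "pmf (map_pmf Some p) (Some x) = pmf p x" "pmf (map_pmf Some p) None = 0"
  by (simp_all add: pmf_map_inj' inj_on_def) (rule pmf_map_outside, auto)

text \<open>Augmentation redirects transitions only out of \<open>X\<close>, and these carry weight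
  zero under a belief that does not charge \<open>X\<close>.\<close>

lemma bayes_weight_augment:
  assumes "set_pmf b \<inter> X = {}"
  shows "bayes_weight (augment M X zT) (map_pmf Some b) a z (Some s') = bayes_weight M b a z s'"
    and "bayes_weight (augment M X zT) (map_pmf Some b) a z None = 0"
proof -
  have eq: "pmf (trans (augment M X zT) (Some s) a) (Some s') * pmf b s =
      pmf (trans M s a) s' * pmf b s" for s
    using assms by (cases "s \<in> X") (auto simp: augment_def pmf_map_Some set_pmf_iff)
  have "obs (augment M X zT) (Some s') a = obs M s' a"
    by (simp add: augment_def)
  then show "bayes_weight (augment M X zT) (map_pmf Some b) a z (Some s') = bayes_weight M b a z s'"
    unfolding bayes_weight_def sum_UNIV_option pmf_map_Some eq by simp
  have eq0: "pmf (trans (augment M X zT) (Some s) a) None * pmf b s = 0" for s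
    using assms by (cases "s \<in> X") (auto simp: augment_def pmf_map_Some set_pmf_iff)
  show "bayes_weight (augment M X zT) (map_pmf Some b) a z None = 0"
    unfolding bayes_weight_def sum_UNIV_option pmf_map_Some eq0 by simp
qed

lemma belief_update_augment:
  assumes "set_pmf b \<inter> X = {}"
  shows "belief_update (augment M X zT) (map_pmf Some b) a z = map_pmf Some (belief_update M b a z)"
proof -
  note weights = sum_UNIV_option bayes_weight_augment[OF assms]
  show ?thesis
  proof (cases "(\<Sum>s\<in>UNIV. bayes_weight M b a z s) = 0")
    \<comment> \<open>Both normalizers vanish, and both updates fall back on the old belief.\<close>
    case True
    then show ?thesis by (simp add: belief_update_def weights)
  next
    case False
    then have "pmf (belief_update (augment M X zT) (map_pmf Some b) a z) x =
        pmf (map_pmf Some (belief_update M b a z)) x" for x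
      by (cases x) (simp_all add: pmf_belief_update weights pmf_map_Some)
    then show ?thesis by (rule pmf_eqI)
  qed
qed

text \<open>By the posterior property, every state in the support of an attained belief occurs
  jointly with that belief, so a belief charging \<open>X\<close> would give \<open>X\<close>
  positive probability.\<close>

lemma joint_law_belief_disjoint:
  assumes "prob_in_at M \<pi> X t = 0" and "(s, b) \<in> set_pmf (joint_law M \<pi> t)"
  shows "s \<notin> X" and "set_pmf b \<inter> X = {}"
proof -
  have out: "s' \<notin> X" if "(s', b') \<in> set_pmf (joint_law M \<pi> t)" for s' b'
    using assms(1) that by (auto simp: prob_in_at_joint_law measure_pmf_zero_iff)
  from out assms(2) show "s \<notin> X" by blast
  have "(s', b) \<in> set_pmf (joint_law M \<pi> t)" if "s' \<in> set_pmf b" for s'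
    using that assms(2) by (subst joint_law_posterior) force
  with out show "set_pmf b \<inter> X = {}" by blast
qed

text \<open>
  As long as \<open>X\<close> has not been visited with positive probability, no belief charges \<open>X\<close>, so the
  augmented POMDP runs in lockstep with the original one under the policy that forgets \<open>Some\<close>.
\<close>

lemma joint_law_augment:
  assumes "\<And>j. j < t \<Longrightarrow> prob_in_at M \<pi> X j = 0"
  shows "joint_law (augment M X zT) (\<lambda>b. \<pi> (map_pmf the b)) t =
    map_pmf (\<lambda>(s, b). (Some s, map_pmf Some b)) (joint_law M \<pi> t)"
  using assms
proof (induction t)
  case 0
  then show ?case
    by (simp add: joint_init_def augment_def map_pmf_comp)
next
  case (Suc t)
  let ?\<phi> = "\<lambda>(s, b). (Some s, map_pmf Some b)"
  \<comment> \<open>\<open>map_pmf the\<close> inverts \<open>map_pmf Some\<close>, so both policies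
    choose the same action on corresponding beliefs.\<close>
  let ?\<pi> = "\<lambda>b. \<pi> (map_pmf the b)"
  have step: "joint_step (augment M X zT) ?\<pi> (?\<phi> x) = map_pmf ?\<phi> (joint_step M \<pi> x)"
    if x: "x \<in> set_pmf (joint_law M \<pi> t)" for x
  proof (cases x)
    case (Pair s b)
    note disjoint = joint_law_belief_disjoint[OF Suc.prems[OF lessI] x[unfolded Pair]]
    have trans: "trans (augment M X zT) (Some s) a = map_pmf Some (trans M s a)" for a
      using disjoint(1) by (simp add: augment_def)
    have obs: "obs (augment M X zT) (Some s') a = obs M s' a" for s' a
      by (simp add: augment_def)
    show ?thesis
      by (simp add: Pair joint_step_def trans obs map_pmf_comp bind_map_pmf map_bind_pmf
          belief_update_augment[OF disjoint(2)])
  qed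
  have "joint_law (augment M X zT) ?\<pi> (Suc t) =
      bind_pmf (joint_law M \<pi> t) (\<lambda>x. joint_step (augment M X zT) ?\<pi> (?\<phi> x))"
    using Suc by (simp add: bind_map_pmf)
  also have "\<dots> = bind_pmf (joint_law M \<pi> t) (\<lambda>x. map_pmf ?\<phi> (joint_step M \<pi> x))"
    by (intro bind_pmf_cong refl step)
  finally show ?case by (simp add: map_bind_pmf)
qed

text \<open>At the least time \<open>t\<close> at which \<open>X\<close> has positive probability
  the two processes still agree, since the lockstep asks for null visits only strictly before
  \<open>t\<close>.\<close>

lemma augment_reachable:
  assumes "reach_prob M \<pi> X > 0"
  shows "reach_prob (augment M X zT) (\<lambda>b. \<pi> (map_pmf the b)) (Some ` X) > 0"
proof -
  obtain t\<^sub>0 where "prob_in_at M \<pi> X t\<^sub>0 > 0"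
    using reach_prob_pos_imp[OF assms] .
  then obtain t where t: "prob_in_at M \<pi> X t > 0"
    and least: "\<And>j. j < t \<Longrightarrow> \<not> prob_in_at M \<pi> X j > 0"
    using exists_least_iff[of "\<lambda>t. prob_in_at M \<pi> X t > 0"] by blast
  have "prob_in_at (augment M X zT) (\<lambda>b. \<pi> (map_pmf the b)) (Some ` X) t = prob_in_at M \<pi> X t"
  proof -
    have "prob_in_at M \<pi> X j = 0" if "j < t" for j
      using least[OF that] prob_in_at_nonneg[of M \<pi> X j] by simp
    then show ?thesis
      by (simp add: prob_in_at_joint_law joint_law_augment case_prod_unfold vimage_def image_iff)
  qed
  with t prob_in_at_le_reach_prob[of "augment M X zT" _ "Some ` X" t] show ?thesis
    by (metis less_le_trans)
qed

section \<open>The strict inequality\<close>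

theorem proposition1:
  fixes M :: "('s::finite, 'a::finite, 'o::finite) pomdp"
    and T :: "'s set"
    and zT :: "'a \<Rightarrow> 'o pmf"
    and \<gamma> :: real
    and \<pi>\<^sub>\<gamma> :: "('s option, 'a) policy"
  assumes reachable: "\<exists>\<pi>. reach_prob M \<pi> T > 0"
    and not_early: "\<not> (\<exists>\<pi>. prob_in_at M \<pi> T 0 > 0 \<or> prob_in_at M \<pi> T 1 > 0)"
    and discount: "0 \<le> \<gamma>" "\<gamma> < 1"
    and optimal: "\<And>\<pi>. discounted_value (augment M T zT) (reach_reward T) \<gamma> \<pi>
                      \<le> discounted_value (augment M T zT) (reach_reward T) \<gamma> \<pi>\<^sub>\<gamma>"
  shows "discounted_value (augment M T zT) (reach_reward T) \<gamma> \<pi>\<^sub>\<gamma>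
           < (SUP \<pi>. reach_prob (augment M T zT) \<pi> (Some ` T))"
proof -
  let ?M = "augment M T zT"
  let ?S = "SUP \<pi>. reach_prob ?M \<pi> (Some ` T)"
  have "reach_prob ?M \<pi> (Some ` T) \<le> 1" for \<pi>
    unfolding reach_prob_def by (intro prob_space.prob_le_1 prob_space_trajectories)
  \<comment> \<open>A supremum of reals dominates its family only once boundedness is known.\<close>
  then have "bdd_above (range (\<lambda>\<pi>. reach_prob ?M \<pi> (Some ` T)))"
    by (auto intro!: bdd_aboveI)
  then have upper: "reach_prob ?M \<pi> (Some ` T) \<le> ?S" for \<pi>
    by (rule cSUP_upper[OF UNIV_I])
  from reachable obtain \<pi> where "reach_prob M \<pi> T > 0" by blast
  from augment_reachable[OF this] upper have pos: "?S > 0"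
    by (rule less_le_trans)
  have "prob_in_at M \<pi> T 0 = 0"
    using not_early prob_in_at_nonneg[of M \<pi> T 0] by (intro order.antisym) (auto simp: not_less)
  then have "prob_in_at ?M \<pi>\<^sub>\<gamma> (Some ` T) 0 = 0"
    by (auto simp: prob_in_at_joint_law joint_init_def augment_def measure_pmf_zero_iff)
  from discounted_value_augment_le[OF discount this]
  have "discounted_value ?M (reach_reward T) \<gamma> \<pi>\<^sub>\<gamma> \<le> \<gamma> * reach_prob ?M \<pi>\<^sub>\<gamma> (Some ` T)" .
  also have "\<dots> \<le> \<gamma> * ?S"
    using discount upper by (intro mult_left_mono)
  \<comment> \<open>Strictness comes from \<open>\<gamma> < 1\<close> together with positivity of
    the supremum.\<close>
  also have "\<dots> < ?S"
    using discount pos by simp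
  finally show ?thesis .
qed

end
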